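(* Let $A=(A,\tau)$ be a finite quasilinear cycle set. Then the group $\tilde{\mathcal G}(A)$ acts transitively on the set $\mathcal G(A)$ via $$\alpha:\tilde{\mathcal G}(A)\times\mathcal G(A)\to\mathcal G(A),\qquad (\gamma_a\circ g,\,c)\mapsto\alpha_{\gamma_a\circ g}(c)=\tilde\lambda_{\gamma_a}(g\circ c)\qquad(a\in A,\ g\in\mathcal G(A)).$$
   Context: A cycle set is a set $X$ with a binary operation $\ast$ such that for every $x\in X$ the map $\sigma_x:X\to X$, $y\mapsto x\ast y$, is bijective, and $(x\ast y)\ast(x\ast z)=(y\ast x)\ast(y\ast z)$ for all $x,y,z\in X$, and the diagonal map $x\mapsto x\ast x$ is bijective (for finite $X$ this last condition is automatic). A quasilinear cycle set is a pair $(A,\tau)$, where $A$ is an abelian group (written additively) and $\tau:A\to A$ is a bijection with $\tau(0)=0$, such that $A$ is a cycle set under the operation $a\ast b=\tau(b-a)-\tau(-a)$. A (left) brace is a set $B$ with operations $+,\circ$ such that $(B,+)$ is an abelian group, $(B,\circ)$ is a group and $a\circ(b+c)+a=a\circ b+a\circ c$ for all $a,b,c\in B$. $\mathfrak S_A$ is the symmetric group on the set $A$, with composition $\circ$. The permutation group is $\mathcal G(A)=\langle\sigma_a: a\in A\rangle\leq\mathfrak S_A$, and $\lambda_a:=\sigma_a^{-1}\in\mathcal G(A)$ for $a\in A$. It is known that there is a unique addition $+$ on $\mathcal G(A)$ such that $(\mathcal G(A),+,\circ)$ is a brace and $\lambda_x\circ\lambda_y=\lambda_x+\lambda_{\lambda_x(y)}$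 for all $x,y\in A$. For $a\in A$ let $\gamma_a:A\to A$, $b\mapsto a+b$, and $\Gamma_A=\{\gamma_a:a\in A\}$. The extended permutation group is $\tilde{\mathcal G}(A)=\Gamma_A\circ\mathcal G(A)$, a subgroup of $\mathfrak S_A$; since $\Gamma_A\cap\mathcal G(A)$ is trivial, each of its elements is uniquely of the form $\gamma_a\circ g$ with $a\in A$, $g\in\mathcal G(A)$. The $\tilde\lambda$-action is the unique group homomorphism $\tilde\lambda:\tilde{\mathcal G}(A)\to\operatorname{Aut}(\mathcal G(A),+)$, $g\mapsto\tilde\lambda_g$, such that $\tilde\lambda_g(\lambda_a)=\lambda_{g(a)}$ for all $g\in\tilde{\mathcal G}(A)$, $a\in A$ (such a homomorphism exists and is unique). *)

theory Defs
  imports "HOL-Algebra.Ring" "HOL-Algebra.Generated_Groups" "HOL-Algebra.Group_Action"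
begin

definition cycle_set :: "'a set \<Rightarrow> ('a \<Rightarrow> 'a \<Rightarrow> 'a) \<Rightarrow> bool" where
  "cycle_set S star \<longleftrightarrow>
     (\<forall>x\<in>S. bij_betw (star x) S S) \<and>
     (\<forall>x\<in>S. \<forall>y\<in>S. \<forall>z\<in>S. star (star x y) (star x z) = star (star y x) (star y z)) \<and>
     bij_betw (\<lambda>x. star x x) S S"

text \<open>The abelian group \<open>A\<close> is given by the type class, with the whole type as underlying set. The
  groups of permutations of \<open>A\<close> are HOL-Algebra structures.\<close>

definition qstar :: "('a::ab_group_add \<Rightarrow> 'a) \<Rightarrow> 'a \<Rightarrow> 'a \<Rightarrow> 'a" where
  "qstar \<tau> a b = \<tau> (b - a) - \<tau> (- a)"

definition quasilinear_cycle_set :: "('a::ab_group_add \<Rightarrow> 'a) \<Rightarrow> bool" where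
  "quasilinear_cycle_set \<tau> \<longleftrightarrow> bij \<tau> \<and> \<tau> 0 = 0 \<and> cycle_set UNIV (qstar \<tau>)"

locale brace = abelian_group B + group B for B (structure) +
  assumes brace_compat: "\<lbrakk> a \<in> carrier B; b \<in> carrier B; c \<in> carrier B \<rbrakk> \<Longrightarrow>
    a \<otimes> (b \<oplus> c) \<oplus> a = a \<otimes> b \<oplus> a \<otimes> c"

abbreviation Sym :: "('a \<Rightarrow> 'a) monoid" where
  "Sym \<equiv> BijGroup UNIV"

definition perm_group :: "('a::ab_group_add \<Rightarrow> 'a) \<Rightarrow> ('a \<Rightarrow> 'a) monoid" where
  "perm_group \<tau> = Sym\<lparr>carrier := generate Sym (range (qstar \<tau>))\<rparr>"

definition lam :: "('a::ab_group_add \<Rightarrow> 'a) \<Rightarrow> 'a \<Rightarrow> ('a \<Rightarrow> 'a)" where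
  "lam \<tau> a = inv\<^bsub>Sym\<^esub> (qstar \<tau> a)"

text \<open>A choice rather than a definite description: the addition is unique on the permutation group,
  but a HOL function also has irrelevant values outside the carrier. The same applies to
  \<open>lam_tilde\<close> below.\<close>

definition perm_brace :: "('a::ab_group_add \<Rightarrow> 'a) \<Rightarrow> ('a \<Rightarrow> 'a) ring" where
  "perm_brace \<tau> = (SOME B. brace B \<and>
     carrier B = carrier (perm_group \<tau>) \<and>
     mult B = mult (perm_group \<tau>) \<and>
     one B = one (perm_group \<tau>) \<and>
     (\<forall>x y. lam \<tau> x \<otimes>\<^bsub>B\<^esub> lam \<tau> y = lam \<tau> x \<oplus>\<^bsub>B\<^esub> lam \<tau> (lam \<tau> x y)))"

definition transl :: "'a::ab_group_add \<Rightarrow> 'a \<Rightarrow> 'a" where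
  "transl a = (\<lambda>b. a + b)"

definition ext_perm_group :: "('a::ab_group_add \<Rightarrow> 'a) \<Rightarrow> ('a \<Rightarrow> 'a) monoid" where
  "ext_perm_group \<tau> = Sym\<lparr>carrier := range transl <#>\<^bsub>Sym\<^esub> carrier (perm_group \<tau>)\<rparr>"

definition lam_tilde :: "('a::ab_group_add \<Rightarrow> 'a) \<Rightarrow> ('a \<Rightarrow> 'a) \<Rightarrow> ('a \<Rightarrow> 'a) \<Rightarrow> ('a \<Rightarrow> 'a)" where
  "lam_tilde \<tau> = (SOME \<Lambda>.
     \<Lambda> \<in> hom (ext_perm_group \<tau>) (AutoGroup (add_monoid (perm_brace \<tau>))) \<and>
     (\<forall>g \<in> carrier (ext_perm_group \<tau>). \<forall>a. \<Lambda> g (lam \<tau> a) = lam \<tau> (g a)))"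

text \<open>The pair \<open>(a, g)\<close> below is the unique decomposition \<open>h = transl a \<circ> g\<close>. The restriction to the
  carrier is needed because the elements of \<^const>\<open>BijGroup\<close> are extensional functions.\<close>

definition alpha :: "('a::ab_group_add \<Rightarrow> 'a) \<Rightarrow> ('a \<Rightarrow> 'a) \<Rightarrow> ('a \<Rightarrow> 'a) \<Rightarrow> ('a \<Rightarrow> 'a)" where
  "alpha \<tau> h = (\<lambda>c \<in> carrier (perm_group \<tau>).
     let (a, g) = (THE (a, g). g \<in> carrier (perm_group \<tau>) \<and> h = transl a \<otimes>\<^bsub>Sym\<^esub> g)
     in lam_tilde \<tau> (transl a) (g \<otimes>\<^bsub>perm_group \<tau>\<^esub> c))"

end

theory Submission
  imports Defs "HOL-Library.Multiset"
begin

text \<open>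
  The operation of a finite cycle set extends to finite multisets by
  \<open>\<sigma>\<^bsub>m+x\<^esub> = \<sigma>\<^bsub>\<sigma>\<^sub>m(x)\<^esub> \<circ> \<sigma>\<^sub>m\<close>, and every element of the permutation group is
  \<open>\<lambda>\<^sub>m = \<sigma>\<^sub>m\<^sup>-\<^sup>1\<close> for some multiset \<open>m\<close>. The brace addition is the only possible one,
  \<open>\<lambda>\<^sub>m + \<lambda>\<^sub>n = \<lambda>\<^bsub>m+n\<^esub>\<close>, and the action of \<open>h\<close> in the extended permutation group is
  \<open>\<lambda>\<^sub>m \<mapsto> \<lambda>\<^bsub>h(m)\<^esub>\<close>. For a quasilinear cycle set this is well defined because
  \<open>\<lambda>\<^bsub>\<gamma>\<^sub>a(m)\<^esub> = \<gamma>\<^sub>a \<circ> \<lambda>\<^sub>m \<circ> \<gamma>\<^sub>t\<close> with \<open>t = \<sigma>\<^sub>m(-a)\<close>. Hence \<open>\<alpha>\<^sub>h(c)\<close> lies in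
  the coset \<open>h \<circ> c \<circ> \<Gamma>\<close>, which meets the permutation group in a single element because all
  permutations in that group fix \<open>0\<close>. So \<open>\<alpha>\<close> is the action of the extended permutation group
  on its left cosets of \<open>\<Gamma>\<close>, with the permutation group as a system of representatives.
\<close>

section \<open>The symmetric group in terms of ordinary functions\<close>

lemma carrier_Sym: "carrier Sym = {f. bij f}"
  by (simp add: BijGroup_def Bij_def)

lemma mult_Sym: "bij f \<Longrightarrow> bij g \<Longrightarrow> f \<otimes>\<^bsub>Sym\<^esub> g = f \<circ> g"
  by (simp add: BijGroup_def Bij_def compose_def restrict_def fun_eq_iff)

lemma one_Sym: "\<one>\<^bsub>Sym\<^esub> = id"
  by (simp add: BijGroup_def fun_eq_iff)

lemma inv_Sym: "bij f \<Longrightarrow> inv\<^bsub>Sym\<^esub> f = inv_into UNIV f"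
  by (subst inv_BijGroup) (simp_all add: Bij_def restrict_def)

section \<open>Finite cycle sets: the extension to multisets and the permutation group\<close>

locale finite_cycle_set =
  fixes s :: "'a::finite \<Rightarrow> 'a \<Rightarrow> 'a"
  assumes bij_s: "bij (s x)"
    and cycle: "s (s x y) (s x z) = s (s y x) (s y z)"
begin

definition sigma :: "'a multiset \<Rightarrow> 'a \<Rightarrow> 'a" where
  "sigma m = fold_mset (\<lambda>x f. s (f x) \<circ> f) id m"

definition L :: "'a multiset \<Rightarrow> 'a \<Rightarrow> 'a" where
  "L m = inv_into UNIV (sigma m)"

lemma sigma_empty [simp]: "sigma {#} = id"
  by (simp add: sigma_def)

text \<open>The cycle set identity says exactly that the folded steps commute, so the order in which
  elements enter the multiset does not matter.\<close>

lemma sigma_add_mset: "sigma (add_mset x m) = s (sigma m x) \<circ> sigma m"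
proof -
  interpret comp_fun_commute "\<lambda>x f. s (f x) \<circ> f"
    by standard (auto simp: fun_eq_iff cycle)
  show ?thesis by (simp add: sigma_def)
qed

lemma bij_sigma: "bij (sigma m)"
proof (induction m)
  case empty
  show ?case unfolding sigma_empty by (rule bij_id)
next
  case (add x m)
  then show ?case unfolding sigma_add_mset by (rule bij_comp) (rule bij_s)
qed

lemma bij_L: "bij (L m)"
  by (simp add: L_def bij_sigma bij_imp_bij_inv)

lemma sigma_L [simp]: "sigma m (L m x) = x" and L_sigma [simp]: "L m (sigma m x) = x"
  by (simp_all add: L_def bij_sigma bij_is_surj surj_f_inv_f bij_is_inj)

lemma sigma_comp_L [simp]: "sigma m \<circ> L m = id" and L_comp_sigma [simp]: "L m \<circ> sigma m = id"
  by (simp_all add: fun_eq_iff)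

lemma inv_L: "inv_into UNIV (L m) = sigma m"
  by (simp add: L_def bij_sigma inv_inv_eq)

lemma L_empty [simp]: "L {#} = id"
  by (simp add: L_def)

lemma L_single: "L {#x#} = inv_into UNIV (s x)"
  by (simp add: L_def sigma_add_mset)

lemma sigma_union: "sigma (m + n) = sigma (image_mset (sigma m) n) \<circ> sigma m"
  by (induction n) (auto simp: sigma_add_mset fun_eq_iff)

lemma L_union: "L (m + n) = L m \<circ> L (image_mset (sigma m) n)"
  by (simp add: L_def sigma_union o_inv_distrib bij_sigma)

lemma image_sigma_L [simp]: "image_mset (sigma m) (image_mset (L m) n) = n"
  by (simp add: multiset.map_comp)

text \<open>Twisting \<open>n\<close> by \<open>L m\<close> cancels the \<open>sigma m\<close> in
  \<open>L_union\<close>. Hence \<open>range L\<close> is closed under composition.\<close>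

lemma L_comp: "L m \<circ> L n = L (m + image_mset (L m) n)"
  by (simp add: L_union)

text \<open>A finite set of permutations closed under composition is closed under inversion.\<close>

lemma sigma_in_range_L: "sigma m \<in> range L"
proof -
  have "(\<circ>) (L m) ` range L = range L"
  proof (rule endo_inj_surj)
    show "(\<circ>) (L m) ` range L \<subseteq> range L"
      by (auto simp: L_comp)
    show "inj_on ((\<circ>) (L m)) (range L)"
      by (rule inj_on_inverseI[where g = "(\<circ>) (sigma m)"]) (simp add: o_assoc)
  qed simp
  moreover have "id \<in> range L"
    by (metis L_empty rangeI)
  ultimately obtain f where f: "f \<in> range L" "L m \<circ> f = id"
    by (metis imageE)
  have "sigma m = sigma m \<circ> (L m \<circ> f)"
    by (simp add: f)
  also have "\<dots> = f"
    by (simp add: o_assoc)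
  finally show ?thesis
    using f by simp
qed

text \<open>Makes the sum on \<open>range L\<close> well defined. Since \<open>L k\<close>
  determines its inverse \<open>sigma k\<close>, \<open>L_union\<close> shows that
  \<open>L (k + j)\<close> depends on \<open>k\<close> only through \<open>L k\<close>;
  commutativity handles the other summand.\<close>

lemma L_add_cong:
  assumes "L m = L m'" "L n = L n'"
  shows "L (m + n) = L (m' + n')"
proof -
  have right: "L (k + j) = L (k' + j)" if "L k = L k'" for k k' j
    using that by (metis L_union inv_L)
  have "L (m + n) = L (m' + n)"
    using assms(1) by (rule right)
  also have "\<dots> = L (m' + n')"
    using right[OF assms(2), of m'] by (simp only: add.commute)
  finally show ?thesis .
qed

lemma L_image_sigma: "L (image_mset (sigma k) m) = sigma k \<circ> L (k + m)"
  by (simp add: L_union o_assoc)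

lemma L_image_L_cong: "L m = L m' \<Longrightarrow> L (image_mset (L k) m) = L (image_mset (L k) m')"
proof -
  assume "L m = L m'"
  \<comment> \<open>By finiteness \<open>L k\<close> is itself some \<open>sigma j\<close>, and
    images under \<open>sigma j\<close> reduce to sums by \<open>L_image_sigma\<close>.\<close>
  obtain j where "sigma k = L j"
    using sigma_in_range_L by blast
  then have "L k = sigma j"
    by (metis L_def inv_L)
  moreover have "L (j + m) = L (j + m')"
    using refl \<open>L m = L m'\<close> by (rule L_add_cong)
  ultimately show ?thesis
    by (simp only: L_image_sigma)
qed

text \<open>A multiplicative inverse \<open>L n\<close> of \<open>L m\<close> becomes an additive
  one once \<open>n\<close> is twisted by \<open>L m\<close>.\<close>

lemma L_additive_inverse: "\<exists>n. L (n + m) = id"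
proof -
  obtain n where "sigma m = L n"
    using sigma_in_range_L by blast
  then have "L (m + image_mset (L m) n) = id"
    by (metis L_comp L_comp_sigma)
  then show ?thesis
    unfolding add.commute[of _ m] ..
qed

lemma subgroup_range_L: "subgroup (range L) Sym"
proof (rule group.subgroupI[OF group_BijGroup])
  show "inv\<^bsub>Sym\<^esub> f \<in> range L" if "f \<in> range L" for f
    using that sigma_in_range_L by (auto simp: inv_Sym bij_L inv_L)
  show "f \<otimes>\<^bsub>Sym\<^esub> g \<in> range L" if "f \<in> range L" "g \<in> range L" for f g
    using that by (auto simp: mult_Sym bij_L L_comp)
qed (auto simp: carrier_Sym bij_L)

lemma generate_eq_range_L: "generate Sym (range s) = range L"
proof
  have "s x \<in> range L" for x
    using sigma_in_range_L[of "{#x#}"] by (simp add: sigma_add_mset)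
  then show "generate Sym (range s) \<subseteq> range L"
    by (intro group.generate_subgroup_incl[OF group_BijGroup] subgroup_range_L) auto
  have "sigma m \<in> generate Sym (range s)" for m
  proof (induction m)
    case empty
    show ?case using generate.one[of Sym "range s"] unfolding sigma_empty by (simp only: one_Sym)
  next
    case (add x m)
    then show ?case
      using generate.eng[OF generate.incl[of "s (sigma m x)" "range s" Sym] add]
      by (simp add: mult_Sym bij_s bij_sigma sigma_add_mset comp_def)
  qed
  \<comment> \<open>If \<open>sigma m = L n\<close>, then inverting gives
    \<open>L m = sigma n\<close>, so every \<open>L m\<close> is a product of maps
    \<open>s x\<close>.\<close>
  then show "range L \<subseteq> generate Sym (range s)"
    using sigma_in_range_L by (metis image_subsetI inv_L rangeE inv_inv_eq bij_L)
qed

section \<open>Existence and uniqueness of the brace addition\<close>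

definition rep :: "('a \<Rightarrow> 'a) \<Rightarrow> 'a multiset" where
  "rep f = (SOME m. L m = f)"

lemma L_rep [simp]: "L (rep (L m)) = L m"
  unfolding rep_def by (rule someI[of _ m]) simp

definition cycle_set_brace :: "('a \<Rightarrow> 'a) ring" where
  "cycle_set_brace = \<lparr>carrier = range L, monoid.mult = monoid.mult Sym, one = one Sym, zero = id,
     add = (\<lambda>f g. L (rep f + rep g))\<rparr>"

lemma cycle_set_brace_simps:
  "carrier cycle_set_brace = range L" "monoid.mult cycle_set_brace = monoid.mult Sym"
  "one cycle_set_brace = one Sym" "zero cycle_set_brace = id"
  "L m \<oplus>\<^bsub>cycle_set_brace\<^esub> L n = L (m + n)"
  by (simp_all add: cycle_set_brace_def L_add_cong[OF L_rep L_rep])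

lemma brace_cycle_set_brace: "brace cycle_set_brace"
proof (intro brace.intro brace_axioms.intro)
  show "abelian_group cycle_set_brace"
  proof (rule abelian_groupI)
    show "\<exists>g\<in>carrier cycle_set_brace. g \<oplus>\<^bsub>cycle_set_brace\<^esub> f = \<zero>\<^bsub>cycle_set_brace\<^esub>"
      if "f \<in> carrier cycle_set_brace" for f
      using that L_additive_inverse by (auto simp: cycle_set_brace_simps)
    show "\<zero>\<^bsub>cycle_set_brace\<^esub> \<oplus>\<^bsub>cycle_set_brace\<^esub> f = f" if "f \<in> carrier cycle_set_brace" for f
      using that cycle_set_brace_simps(5)[of "{#}"] by (auto simp: cycle_set_brace_simps)
    show "\<zero>\<^bsub>cycle_set_brace\<^esub> \<in> carrier cycle_set_brace"
      by (metis L_empty cycle_set_brace_simps(1,4) rangeI)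
  qed (auto simp: cycle_set_brace_simps ac_simps)
  show "group cycle_set_brace"
  proof (rule groupI)
    show "\<exists>g\<in>carrier cycle_set_brace. g \<otimes>\<^bsub>cycle_set_brace\<^esub> f = \<one>\<^bsub>cycle_set_brace\<^esub>"
      if "f \<in> carrier cycle_set_brace" for f
    proof -
      obtain m where f: "f = L m"
        using \<open>f \<in> carrier cycle_set_brace\<close> by (auto simp: cycle_set_brace_simps)
      have "sigma m \<otimes>\<^bsub>cycle_set_brace\<^esub> f = \<one>\<^bsub>cycle_set_brace\<^esub>"
        by (simp add: f cycle_set_brace_simps(1-4) mult_Sym one_Sym bij_L bij_sigma)
      then show ?thesis
        using sigma_in_range_L[of m] unfolding cycle_set_brace_simps(1) by (rule bexI)
    qed
    show "\<one>\<^bsub>cycle_set_brace\<^esub> \<in> carrier cycle_set_brace"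
      by (metis L_empty cycle_set_brace_simps(1,3) one_Sym rangeI)
  qed (auto simp: cycle_set_brace_simps(1-4) mult_Sym one_Sym bij_L bij_comp o_assoc L_comp[symmetric],
      auto simp: L_comp)
  fix f g h
  assume "f \<in> carrier cycle_set_brace" "g \<in> carrier cycle_set_brace" "h \<in> carrier cycle_set_brace"
  then obtain k m n where "f = L k" "g = L m" "h = L n"
    by (auto simp: cycle_set_brace_simps)
  \<comment> \<open>By \<open>L_comp\<close> both sides are \<open>L\<close> of the multiset
    \<open>k + k + image_mset (L k) m + image_mset (L k) n\<close>.\<close>
  then show "f \<otimes>\<^bsub>cycle_set_brace\<^esub> (g \<oplus>\<^bsub>cycle_set_brace\<^esub> h) \<oplus>\<^bsub>cycle_set_brace\<^esub> f =
      f \<otimes>\<^bsub>cycle_set_brace\<^esub> g \<oplus>\<^bsub>cycle_set_brace\<^esub> f \<otimes>\<^bsub>cycle_set_brace\<^esub> h"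
    by (simp add: cycle_set_brace_simps mult_Sym bij_L L_comp ac_simps)
qed

lemma cycle_set_brace_lambda:
  "L {#x#} \<otimes>\<^bsub>cycle_set_brace\<^esub> L {#y#} = L {#x#} \<oplus>\<^bsub>cycle_set_brace\<^esub> L {#L {#x#} y#}"
  by (simp add: cycle_set_brace_simps mult_Sym bij_L L_comp)

text \<open>The identity \<open>g \<circ> \<lambda>\<^sub>y = g + \<lambda>\<^bsub>g(y)\<^esub>\<close> is given for generators \<open>g\<close> and passes to
  products by the brace axiom; it determines every sum of the form \<open>g + \<lambda>\<^sub>x\<close>.\<close>

lemma brace_addition_unique:
  assumes "brace B" and car: "carrier B = range L"
    and mult: "monoid.mult B = monoid.mult Sym" and one: "one B = one Sym"
    and lambda: "\<And>x y. L {#x#} \<otimes>\<^bsub>B\<^esub> L {#y#} = L {#x#} \<oplus>\<^bsub>B\<^esub> L {#L {#x#} y#}"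
  shows "L m \<oplus>\<^bsub>B\<^esub> L n = L (m + n)" and "zero B = id"
proof -
  interpret brace B by fact
  have L_car [simp]: "L m \<in> carrier B" for m
    by (simp add: car)
  have mult_L: "L m \<otimes>\<^bsub>B\<^esub> L n = L m \<circ> L n" for m n
    by (simp add: mult mult_Sym bij_L)
  have compat: "L k \<otimes>\<^bsub>B\<^esub> (L m \<oplus>\<^bsub>B\<^esub> L n) \<oplus>\<^bsub>B\<^esub> L k = L k \<otimes>\<^bsub>B\<^esub> L m \<oplus>\<^bsub>B\<^esub> L k \<otimes>\<^bsub>B\<^esub> L n" for k m n
    by (rule brace_compat) simp_all
  show zero: "zero B = id"
  proof -
    \<comment> \<open>This instance reads 1 + 1 = 0 + 1, so the two neutral elements
      coincide.\<close>
    have "\<one>\<^bsub>B\<^esub> \<otimes>\<^bsub>B\<^esub> (\<zero>\<^bsub>B\<^esub> \<oplus>\<^bsub>B\<^esub> \<one>\<^bsub>B\<^esub>) \<oplus>\<^bsub>B\<^esub> \<one>\<^bsub>B\<^esub> = \<one>\<^bsub>B\<^esub> \<otimes>\<^bsub>B\<^esub> \<zero>\<^bsub>B\<^esub> \<oplus>\<^bsub>B\<^esub> \<one>\<^bsub>B\<^esub> \<otimes>\<^bsub>B\<^esub> \<one>\<^bsub>B\<^esub>"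
      by (rule brace_compat) simp_all
    then have "\<one>\<^bsub>B\<^esub> = \<zero>\<^bsub>B\<^esub>"
      by simp
    then show ?thesis
      by (simp add: one one_Sym)
  qed
  define P where "P m \<longleftrightarrow> (\<forall>y. L m \<circ> L {#y#} = L m \<oplus>\<^bsub>B\<^esub> L {#L m y#})" for m
  have P_L: "P m" for m
  proof (induction m)
    case empty
    show ?case
      unfolding P_def using zero by (metis L_car L_empty comp_id id_apply id_comp l_zero)
  next
    case (add x m)
    \<comment> \<open>Chosen so that \<open>L m z = x\<close>: adding \<open>x\<close> to
      \<open>m\<close> becomes right multiplication by the generator \<open>L {#z#}\<close>.\<close>
    define z where "z = sigma m x"
    have L_add: "L (add_mset x m) = L m \<circ> L {#z#}"
      by (simp add: z_def L_comp)
    show ?case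
      unfolding P_def
    proof
      fix y
      let ?w = "L {#L m (L {#z#} y)#}"
      have zy: "L {#z#} \<circ> L {#y#} = L {#z#} \<oplus>\<^bsub>B\<^esub> L {#L {#z#} y#}"
        using lambda[of z y] by (simp add: mult_L)
      have "L m \<otimes>\<^bsub>B\<^esub> (L {#z#} \<circ> L {#y#}) = L m \<circ> (L {#z#} \<circ> L {#y#})"
        using mult_L[of m "{#z#} + image_mset (L {#z#}) {#y#}"] by (simp only: flip: L_comp)
      then have "(L m \<circ> L {#z#} \<circ> L {#y#}) \<oplus>\<^bsub>B\<^esub> L m
          = L m \<otimes>\<^bsub>B\<^esub> (L {#z#} \<oplus>\<^bsub>B\<^esub> L {#L {#z#} y#}) \<oplus>\<^bsub>B\<^esub> L m"
        by (simp only: o_assoc flip: zy)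
      also have "\<dots> = (L m \<circ> L {#z#}) \<oplus>\<^bsub>B\<^esub> (L m \<circ> L {#L {#z#} y#})"
        by (simp only: compat mult_L)
      also have "\<dots> = (L m \<circ> L {#z#}) \<oplus>\<^bsub>B\<^esub> (L m \<oplus>\<^bsub>B\<^esub> ?w)"
        using add by (simp add: P_def)
      also have "\<dots> = ((L m \<circ> L {#z#}) \<oplus>\<^bsub>B\<^esub> ?w) \<oplus>\<^bsub>B\<^esub> L m"
        by (simp add: L_comp a_ac)
      \<comment> \<open>The summand \<open>L m\<close> that the brace law puts on both sides
        cancels.\<close>
      finally have "L m \<circ> L {#z#} \<circ> L {#y#} = (L m \<circ> L {#z#}) \<oplus>\<^bsub>B\<^esub> ?w"
        by (simp add: L_comp)
      then show "L (add_mset x m) \<circ> L {#y#} = L (add_mset x m) \<oplus>\<^bsub>B\<^esub> L {#L (add_mset x m) y#}"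
        by (simp only: L_add o_apply)
    qed
  qed
  have add_single: "L m \<oplus>\<^bsub>B\<^esub> L {#x#} = L (add_mset x m)" for m x
  proof -
    \<comment> \<open>\<open>P m\<close> at \<open>y = sigma m x\<close>, where
      \<open>L m y = x\<close>.\<close>
    have "L m \<oplus>\<^bsub>B\<^esub> L {#x#} = L m \<circ> L {#sigma m x#}"
      using P_L[of m] by (simp add: P_def)
    then show ?thesis
      by (simp add: L_comp)
  qed
  show "L m \<oplus>\<^bsub>B\<^esub> L n = L (m + n)" for m n
  proof (induction n)
    case empty
    show ?case
      using r_zero[OF L_car[of m]] by (simp add: zero id_def)
  next
    case (add x n)
    have "L m \<oplus>\<^bsub>B\<^esub> L (add_mset x n) = (L m \<oplus>\<^bsub>B\<^esub> L n) \<oplus>\<^bsub>B\<^esub> L {#x#}"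
      using a_assoc[of "L m" "L n" "L {#x#}"] by (simp add: add_single)
    then show ?case
      by (simp add: add add_single)
  qed
qed

end

section \<open>Translations and quasilinear cycle sets\<close>

lemma transl_apply [simp]: "transl a b = a + b"
  by (simp add: transl_def)

lemma transl_comp [simp]: "transl a \<circ> transl b = transl (a + b)"
  by (simp add: fun_eq_iff add.assoc)

lemma transl_comp' [simp]: "f \<circ> transl a \<circ> transl b = f \<circ> transl (a + b)"
  by (simp add: fun_eq_iff add.assoc)

lemma transl_zero [simp]: "transl 0 = id"
  by (simp add: fun_eq_iff)

lemma bij_transl: "bij (transl a)"
  by (rule o_bij[of "transl (- a)"]) simp_all

lemma qstar_zero: "qstar \<tau> x 0 = 0"
  by (simp add: qstar_def)

text \<open>The two terms \<open>\<tau> (- x)\<close> on the right cancel. This is how translations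
  enter the computation of \<open>sigma\<close>.\<close>

lemma qstar_diff: "qstar \<tau> (x - a) y = qstar \<tau> x (y + a) - qstar \<tau> x a"
  by (simp add: qstar_def algebra_simps)

locale finite_quasilinear_cycle_set =
  fixes \<tau> :: "'a::{ab_group_add, finite} \<Rightarrow> 'a"
  assumes quasilinear: "quasilinear_cycle_set \<tau>"

sublocale finite_quasilinear_cycle_set \<subseteq> finite_cycle_set "qstar \<tau>"
proof unfold_locales
  have "bij_betw (qstar \<tau> x) UNIV UNIV \<and> qstar \<tau> (qstar \<tau> x y) (qstar \<tau> x z) = qstar \<tau> (qstar \<tau> y x) (qstar \<tau> y z)" for x y z
    using quasilinear unfolding quasilinear_cycle_set_def cycle_set_def by (meson UNIV_I)
  then show "bij (qstar \<tau> x)" "qstar \<tau> (qstar \<tau> x y) (qstar \<tau> x z) = qstar \<tau> (qstar \<tau> y x) (qstar \<tau> y z)" for x y z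
    by (rule conjunct1, rule conjunct2)
qed

context finite_quasilinear_cycle_set
begin

lemma lam_eq_L: "lam \<tau> a = L {#a#}"
  by (simp add: lam_def inv_Sym bij_s L_single)

lemma carrier_perm_group: "carrier (perm_group \<tau>) = range L"
  by (simp add: perm_group_def generate_eq_range_L)

lemma perm_group_simps:
  "monoid.mult (perm_group \<tau>) = monoid.mult Sym" "one (perm_group \<tau>) = one Sym"
  by (simp_all add: perm_group_def)

text \<open>\<open>cycle_set_brace\<close> shows that the choice is from a nonempty set, and
  uniqueness gives the addition and zero of whichever brace is chosen.\<close>

lemma perm_brace:
  shows brace_perm_brace: "brace (perm_brace \<tau>)"
    and carrier_perm_brace: "carrier (perm_brace \<tau>) = range L"
    and add_perm_brace: "L m \<oplus>\<^bsub>perm_brace \<tau>\<^esub> L n = L (m + n)"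
    and zero_perm_brace: "\<zero>\<^bsub>perm_brace \<tau>\<^esub> = id"
proof -
  let ?P = "\<lambda>B. brace B \<and> carrier B = carrier (perm_group \<tau>) \<and>
     monoid.mult B = monoid.mult (perm_group \<tau>) \<and> one B = one (perm_group \<tau>) \<and>
     (\<forall>x y. lam \<tau> x \<otimes>\<^bsub>B\<^esub> lam \<tau> y = lam \<tau> x \<oplus>\<^bsub>B\<^esub> lam \<tau> (lam \<tau> x y))"
  have "?P cycle_set_brace"
    unfolding carrier_perm_group perm_group_simps lam_eq_L
    by (intro conjI allI brace_cycle_set_brace cycle_set_brace_lambda cycle_set_brace_simps(1-3))
  then have *: "?P (perm_brace \<tau>)"
    unfolding perm_brace_def by (rule someI[of ?P])
  then show "brace (perm_brace \<tau>)" and "carrier (perm_brace \<tau>) = range L"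
    unfolding carrier_perm_group by blast+
  show "L m \<oplus>\<^bsub>perm_brace \<tau>\<^esub> L n = L (m + n)" and "\<zero>\<^bsub>perm_brace \<tau>\<^esub> = id"
    by (rule brace_addition_unique;
        use * in \<open>unfold carrier_perm_group perm_group_simps lam_eq_L, blast\<close>)+
qed

lemma sigma_zero [simp]: "sigma m 0 = 0"
  by (induction m) (simp_all add: sigma_add_mset qstar_zero)

lemma L_zero [simp]: "L m 0 = 0"
  by (metis L_sigma sigma_zero)

text \<open>The outer translation is the one that makes the right side fix 0. In the inductive step
  \<open>qstar_diff\<close> is applied with \<open>sigma m (- a)\<close> as the shift.\<close>

lemma sigma_transl:
  "sigma (image_mset (transl a) m) = transl (- sigma m (- a)) \<circ> sigma m \<circ> transl (- a)"
proof (induction m)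
  case (add x m)
  then show ?case
    by (simp add: sigma_add_mset fun_eq_iff qstar_diff)
qed simp

lemma L_transl:
  "L (image_mset (transl a) m) = transl a \<circ> L m \<circ> transl (sigma m (- a))"
  unfolding L_def[of "image_mset (transl a) m"]
  by (rule inv_unique_comp) (simp_all add: sigma_transl fun_eq_iff)

text \<open>\<open>L_transl\<close> for the shift \<open>- L m a\<close>, where
  \<open>sigma m (L m a) = a\<close>. Moving translations to the left is what closes \<Gamma>
  \<circ> G under composition.\<close>

lemma L_transl_swap: "\<exists>n. L m \<circ> transl a = transl (L m a) \<circ> L n"
proof -
  have "L m \<circ> transl a = transl (L m a) \<circ> L (image_mset (transl (- L m a)) m)"
    by (simp add: L_transl fun_eq_iff)
  then show ?thesis ..
qed

section \<open>The extended permutation group\<close>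

lemma carrier_ext_perm_group: "carrier (ext_perm_group \<tau>) = {transl a \<circ> L m | a m. True}"
  by (auto simp: ext_perm_group_def carrier_perm_group set_mult_def mult_Sym bij_transl bij_L)

lemma bij_ext: "h \<in> carrier (ext_perm_group \<tau>) \<Longrightarrow> bij h"
  by (auto simp: carrier_ext_perm_group intro: bij_comp bij_L bij_transl)

lemma mult_ext_perm_group:
  assumes "h \<in> carrier (ext_perm_group \<tau>)" "k \<in> carrier (ext_perm_group \<tau>)"
  shows "h \<otimes>\<^bsub>ext_perm_group \<tau>\<^esub> k = h \<circ> k"
  using mult_Sym[OF assms[THEN bij_ext]] by (simp add: ext_perm_group_def)

lemma transl_in_ext: "transl a \<in> carrier (ext_perm_group \<tau>)"
  unfolding carrier_ext_perm_group by (metis (mono_tags, lifting) L_empty comp_id mem_Collect_eq)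

lemma L_in_ext: "L m \<in> carrier (ext_perm_group \<tau>)"
  unfolding carrier_ext_perm_group by (metis (mono_tags, lifting) transl_zero id_comp mem_Collect_eq)

lemma comp_in_ext:
  assumes "h \<in> carrier (ext_perm_group \<tau>)" "k \<in> carrier (ext_perm_group \<tau>)"
  shows "h \<circ> k \<in> carrier (ext_perm_group \<tau>)"
proof -
  obtain a m b n where h: "h = transl a \<circ> L m" and k: "k = transl b \<circ> L n"
    using assms by (auto simp: carrier_ext_perm_group)
  obtain j where j: "L m \<circ> transl b = transl (L m b) \<circ> L j"
    using L_transl_swap by blast
  have "h \<circ> k = transl a \<circ> (L m \<circ> transl b) \<circ> L n"
    by (simp add: h k o_assoc)
  also have "\<dots> = transl (a + L m b) \<circ> (L j \<circ> L n)"
    by (simp add: j o_assoc)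
  finally show ?thesis
    by (auto simp: carrier_ext_perm_group L_comp)
qed

lemma inv_in_ext:
  assumes "h \<in> carrier (ext_perm_group \<tau>)"
  shows "inv_into UNIV h \<in> carrier (ext_perm_group \<tau>)"
proof -
  obtain a m where h: "h = transl a \<circ> L m"
    using assms by (auto simp: carrier_ext_perm_group)
  obtain n where n: "sigma m = L n"
    using sigma_in_range_L by blast
  have "inv_into UNIV h = L n \<circ> transl (- a)"
    unfolding h by (rule inv_unique_comp) (simp_all add: fun_eq_iff flip: n)
  then show ?thesis
    by (simp add: comp_in_ext L_in_ext transl_in_ext)
qed

lemma group_ext_perm_group: "group (ext_perm_group \<tau>)"
proof -
  have "subgroup (carrier (ext_perm_group \<tau>)) Sym"
  proof (rule group.subgroupI[OF group_BijGroup])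
    show "carrier (ext_perm_group \<tau>) \<noteq> {}"
      using L_in_ext by blast
  qed (auto simp: carrier_Sym bij_ext inv_Sym mult_Sym inv_in_ext comp_in_ext)
  then show ?thesis
    using group.subgroup_imp_group[OF group_BijGroup] by (fastforce simp: ext_perm_group_def)
qed

section \<open>The extended lambda action\<close>

lemma L_image_ext_cong:
  assumes "h \<in> carrier (ext_perm_group \<tau>)" "L m = L m'"
  shows "L (image_mset h m) = L (image_mset h m')"
proof -
  obtain a k where h: "h = transl a \<circ> L k"
    using assms by (auto simp: carrier_ext_perm_group)
  have "L (image_mset (L k) m) = L (image_mset (L k) m')"
    using assms(2) by (rule L_image_L_cong)
  \<comment> \<open>The right side of \<open>L_transl\<close> involves both \<open>L\<close> and
    \<open>sigma\<close> of the multiset.\<close>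
  moreover from this have "sigma (image_mset (L k) m) = sigma (image_mset (L k) m')"
    by (metis inv_L)
  ultimately have "L (image_mset (transl a) (image_mset (L k) m)) = L (image_mset (transl a) (image_mset (L k) m'))"
    by (simp only: L_transl)
  then show ?thesis
    by (simp add: h multiset.map_comp)
qed

text \<open>The candidate for the extended lambda action; restricted because elements of
  \<open>AutoGroup\<close> are extensional.\<close>

definition induced :: "('a \<Rightarrow> 'a) \<Rightarrow> ('a \<Rightarrow> 'a) \<Rightarrow> 'a \<Rightarrow> 'a" where
  "induced h = (\<lambda>f\<in>range L. L (image_mset h (rep f)))"

lemma induced_L: "h \<in> carrier (ext_perm_group \<tau>) \<Longrightarrow> induced h (L m) = L (image_mset h m)"
  unfolding induced_def by (subst restrict_apply') (simp_all only: rangeI L_image_ext_cong[OF _ L_rep])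

lemma induced_auto:
  assumes h: "h \<in> carrier (ext_perm_group \<tau>)"
  shows "induced h \<in> auto (add_monoid (perm_brace \<tau>))"
proof -
  let ?h' = "inv_into UNIV h"
  have inv: "?h' \<circ> h = id" "h \<circ> ?h' = id"
    using bij_ext[OF h] by (simp_all add: bij_is_inj bij_is_surj surj_iff[symmetric])
  have "bij_betw (induced h) (range L) (range L)"
  proof (rule bij_betw_byWitness[where f' = "induced ?h'"])
    show "\<forall>f\<in>range L. induced ?h' (induced h f) = f"
      and "\<forall>f\<in>range L. induced h (induced ?h' f) = f"
      by (simp_all add: induced_L inv_in_ext h multiset.map_comp inv)
  qed (auto simp: induced_L inv_in_ext h)
  then show ?thesis
    using h by (auto simp: auto_def hom_def Bij_def carrier_perm_brace add_perm_brace induced_L)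
      (simp add: induced_def)
qed

lemma induced_hom:
  "induced \<in> hom (ext_perm_group \<tau>) (AutoGroup (add_monoid (perm_brace \<tau>)))"
proof (rule homI)
  fix h k
  assume hk: "h \<in> carrier (ext_perm_group \<tau>)" "k \<in> carrier (ext_perm_group \<tau>)"
  have "induced (h \<circ> k) = compose (range L) (induced h) (induced k)"
  proof (rule extensionalityI)
    show "induced (h \<circ> k) \<in> extensional (range L)"
      by (simp add: induced_def)
    show "induced (h \<circ> k) f = compose (range L) (induced h) (induced k) f" if "f \<in> range L" for f
    proof -
      obtain m where f: "f = L m"
        using \<open>f \<in> range L\<close> by blast
      show ?thesis
        using hk comp_in_ext[OF hk] by (simp add: f compose_eq induced_L multiset.map_comp)
    qed
  qed simp
  moreover have "h \<otimes>\<^bsub>ext_perm_group \<tau>\<^esub> k = h \<circ> k"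
    using hk by (rule mult_ext_perm_group)
  moreover have "induced h \<in> Bij (range L)" "induced k \<in> Bij (range L)"
    using hk[THEN induced_auto] by (simp_all add: auto_def carrier_perm_brace)
  then have "induced h \<otimes>\<^bsub>AutoGroup (add_monoid (perm_brace \<tau>))\<^esub> induced k =
      compose (range L) (induced h) (induced k)"
    by (simp add: AutoGroup_def BijGroup_def carrier_perm_brace)
  ultimately show "induced (h \<otimes>\<^bsub>ext_perm_group \<tau>\<^esub> k) =
      induced h \<otimes>\<^bsub>AutoGroup (add_monoid (perm_brace \<tau>))\<^esub> induced k"
    by simp
qed (use induced_auto in \<open>simp add: AutoGroup_def\<close>)

text \<open>\<open>induced\<close> witnesses that a suitable homomorphism exists. Any such choice is
  additive and prescribed on the maps \<open>L {#x#}\<close>, which generate the additive group, so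
  induction on \<open>m\<close> determines it on \<open>range L\<close>.\<close>

lemma lam_tilde_L:
  assumes h: "h \<in> carrier (ext_perm_group \<tau>)"
  shows "lam_tilde \<tau> h (L m) = L (image_mset h m)"
proof -
  let ?P = "\<lambda>\<Lambda>. \<Lambda> \<in> hom (ext_perm_group \<tau>) (AutoGroup (add_monoid (perm_brace \<tau>))) \<and>
     (\<forall>g \<in> carrier (ext_perm_group \<tau>). \<forall>a. \<Lambda> g (lam \<tau> a) = lam \<tau> (g a))"
  have "?P induced"
    using induced_hom by (simp add: lam_eq_L induced_L)
  then have *: "?P (lam_tilde \<tau>)"
    unfolding lam_tilde_def by (rule someI[of ?P])
  interpret brace "perm_brace \<tau>"
    by (rule brace_perm_brace)
  have "lam_tilde \<tau> h \<in> auto (add_monoid (perm_brace \<tau>))"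
    using hom_in_carrier[OF conjunct1[OF *] h] by (simp add: AutoGroup_def)
  then have hom: "lam_tilde \<tau> h \<in> hom (add_monoid (perm_brace \<tau>)) (add_monoid (perm_brace \<tau>))"
    by (simp add: auto_def)
  have plus: "lam_tilde \<tau> h (L (m + n)) = lam_tilde \<tau> h (L m) \<oplus>\<^bsub>perm_brace \<tau>\<^esub> lam_tilde \<tau> h (L n)" for m n
    using hom_mult[OF hom, of "L m" "L n"] by (simp add: carrier_perm_brace add_perm_brace)
  show ?thesis
  proof (induction m)
    case empty
    show ?case
      using hom_one[OF hom add.is_group add.is_group] by (simp add: zero_perm_brace id_def)
  next
    case (add x m)
    have "lam_tilde \<tau> h (L {#x#}) = L {#h x#}"
      using * h by (simp add: lam_eq_L)
    then show ?case
      using plus[of "{#x#}" m] by (simp add: add add_perm_brace)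
  qed
qed

section \<open>The map \<open>alpha\<close> and its transitivity\<close>

lemma decomposition_unique:
  assumes "transl a \<circ> L m = transl b \<circ> L n"
  shows "a = b \<and> L m = L n"
proof -
  \<comment> \<open>Every \<open>L m\<close> fixes 0, so the value at 0 is the translation
    part.\<close>
  have "a = b"
    using fun_cong[OF assms, of 0] by simp
  then show ?thesis
    using assms by (auto simp: fun_eq_iff)
qed

lemma alpha_eq:
  "alpha \<tau> (transl a \<circ> L n) (L m) = transl a \<circ> L n \<circ> L m \<circ> transl (sigma m (sigma n (- a)))"
proof -
  have "(THE (b, g). g \<in> range L \<and> transl a \<circ> L n = transl b \<otimes>\<^bsub>Sym\<^esub> g) = (a, L n)"
  proof (rule the_equality)
    fix p
    assume "case p of (b, g) \<Rightarrow> g \<in> range L \<and> transl a \<circ> L n = transl b \<otimes>\<^bsub>Sym\<^esub> g"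
    then obtain b k where "p = (b, L k)" "transl a \<circ> L n = transl b \<circ> L k"
      by (auto simp: mult_Sym bij_transl bij_L)
    then show "p = (a, L n)"
      using decomposition_unique[of a n b k] by simp
  qed (simp add: mult_Sym bij_transl bij_L)
  then have "alpha \<tau> (transl a \<circ> L n) (L m) = lam_tilde \<tau> (transl a) (L n \<circ> L m)"
    by (simp add: alpha_def carrier_perm_group perm_group_simps mult_Sym bij_L)
  also have "\<dots> = transl a \<circ> L (n + image_mset (L n) m) \<circ> transl (sigma (n + image_mset (L n) m) (- a))"
    by (simp only: L_comp lam_tilde_L transl_in_ext L_transl)
  finally show ?thesis
    \<comment> \<open>\<open>sigma_union\<close> splits the last \<open>sigma\<close> into
      \<open>sigma m \<circ> sigma n\<close>.\<close>
    by (simp add: sigma_union o_assoc flip: L_comp)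
qed

lemma alpha_closed:
  assumes "h \<in> carrier (ext_perm_group \<tau>)" "c \<in> range L"
  shows "alpha \<tau> h c \<in> range L"
proof -
  obtain a n m where h: "h = transl a \<circ> L n" and c: "c = L m"
    using assms by (auto simp: carrier_ext_perm_group)
  have "alpha \<tau> h c = L (image_mset (transl a) (n + image_mset (L n) m))"
    unfolding h c alpha_eq L_transl by (simp add: sigma_union o_assoc flip: L_comp)
  then show ?thesis
    by simp
qed

lemma alpha_coset:
  assumes "h \<in> carrier (ext_perm_group \<tau>)" "c \<in> range L"
  shows "\<exists>t. alpha \<tau> h c = h \<circ> c \<circ> transl t"
  using assms alpha_eq by (auto simp: carrier_ext_perm_group)

lemma coset_unique:
  assumes "inj f" "f \<circ> transl s \<in> range L" "f \<circ> transl t \<in> range L"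
  shows "f \<circ> transl s = f \<circ> transl t"
proof -
  have "f s = 0" "f t = 0"
    using assms(2,3) L_zero by (metis (no_types) rangeE comp_apply transl_apply add_0_right)+
  then show ?thesis
    using \<open>inj f\<close> by (metis injD)
qed

text \<open>Identifies \<open>alpha \<tau> h c\<close> as the one member of the coset that lies in
  \<open>range L\<close>, so the action laws need only some translation that leads there.\<close>

lemma alpha_eqI:
  assumes h: "h \<in> carrier (ext_perm_group \<tau>)" and c: "c \<in> range L"
    and "h \<circ> c \<circ> transl t \<in> range L"
  shows "alpha \<tau> h c = h \<circ> c \<circ> transl t"
proof -
  obtain u where u: "alpha \<tau> h c = h \<circ> c \<circ> transl u"
    using alpha_coset[OF h c] by blast
  have "inj (h \<circ> c)"
    using bij_ext[OF h] c bij_L by (auto intro: inj_compose bij_is_inj)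
  then show ?thesis
    using coset_unique[of "h \<circ> c" u t] assms(3) alpha_closed[OF h c] by (simp add: u)
qed

lemma alpha_id: "c \<in> range L \<Longrightarrow> alpha \<tau> id c = c"
  using alpha_eqI[of id c 0] transl_in_ext[of 0] by simp

lemma alpha_comp:
  assumes h: "h \<in> carrier (ext_perm_group \<tau>)" and k: "k \<in> carrier (ext_perm_group \<tau>)"
    and c: "c \<in> range L"
  shows "alpha \<tau> (h \<circ> k) c = alpha \<tau> h (alpha \<tau> k c)"
proof -
  note kc = alpha_closed[OF k c]
  obtain t u where t: "alpha \<tau> k c = k \<circ> c \<circ> transl t"
    and u: "alpha \<tau> h (alpha \<tau> k c) = h \<circ> alpha \<tau> k c \<circ> transl u"
    using alpha_coset[OF k c] alpha_coset[OF h kc] by blast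
  \<comment> \<open>Applying \<open>alpha\<close> twice also stays in the coset of
    \<open>h \<circ> k \<circ> c\<close>.\<close>
  have *: "alpha \<tau> h (alpha \<tau> k c) = h \<circ> k \<circ> c \<circ> transl (t + u)"
    unfolding u by (simp add: t o_assoc)
  then show ?thesis
    using alpha_eqI[OF comp_in_ext[OF h k] c] alpha_closed[OF h kc] by simp
qed

lemma alpha_Bij:
  assumes h: "h \<in> carrier (ext_perm_group \<tau>)"
  shows "alpha \<tau> h \<in> Bij (range L)"
proof -
  let ?h' = "inv_into UNIV h"
  have inv: "?h' \<circ> h = id" "h \<circ> ?h' = id"
    using bij_ext[OF h] by (simp_all add: bij_is_inj bij_is_surj surj_iff[symmetric])
  have "bij_betw (alpha \<tau> h) (range L) (range L)"
    by (rule bij_betw_byWitness[where f' = "alpha \<tau> ?h'"])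
      (use alpha_closed alpha_comp[OF h inv_in_ext[OF h]] alpha_comp[OF inv_in_ext[OF h] h]
        alpha_id h inv_in_ext[OF h] in \<open>auto simp: inv simp del: o_apply\<close>)
  then show ?thesis
    by (simp add: Bij_def alpha_def carrier_perm_group)
qed

lemma transitive_action_alpha:
  "transitive_action (ext_perm_group \<tau>) (range L) (alpha \<tau>)"
proof (intro transitive_action.intro group_action.intro transitive_action_axioms.intro)
  show "group_hom (ext_perm_group \<tau>) (BijGroup (range L)) (alpha \<tau>)"
  proof (intro group_hom.intro group_hom_axioms.intro homI)
    fix h k
    assume hk: "h \<in> carrier (ext_perm_group \<tau>)" "k \<in> carrier (ext_perm_group \<tau>)"
    have "alpha \<tau> (h \<circ> k) = compose (range L) (alpha \<tau> h) (alpha \<tau> k)"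
    proof (rule extensionalityI)
      show "alpha \<tau> (h \<circ> k) \<in> extensional (range L)"
        by (simp add: alpha_def carrier_perm_group)
    qed (simp_all add: compose_eq alpha_comp hk)
    then show "alpha \<tau> (h \<otimes>\<^bsub>ext_perm_group \<tau>\<^esub> k) = alpha \<tau> h \<otimes>\<^bsub>BijGroup (range L)\<^esub> alpha \<tau> k"
      unfolding mult_ext_perm_group[OF hk] using hk by (simp add: BijGroup_def alpha_Bij)
  qed (use group_ext_perm_group group_BijGroup alpha_Bij in \<open>auto simp: BijGroup_def\<close>)
  fix f g
  assume f: "f \<in> range L" and g: "g \<in> range L"
  obtain m n where "f = L m" "g = L n"
    using f g by blast
  \<comment> \<open>Here \<open>sigma m\<close> is the inverse of \<open>f\<close>, so
    \<open>g \<circ> sigma m\<close> carries \<open>f\<close> to \<open>g\<close> by composition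
    alone, with translation 0.\<close>
  then have gf: "g \<circ> sigma m \<circ> f = g"
    by (simp add: fun_eq_iff)
  have h: "g \<circ> sigma m \<in> carrier (ext_perm_group \<tau>)"
    using comp_in_ext g sigma_in_range_L[of m] L_in_ext by (metis imageE)
  have "alpha \<tau> (g \<circ> sigma m) f = g"
    using alpha_eqI[OF h f, of 0] g by (simp add: gf)
  then show "\<exists>h\<in>carrier (ext_perm_group \<tau>). alpha \<tau> h f = g"
    using h by blast
qed

end

theorem proposition5p6:
  fixes \<tau> :: "'a::{ab_group_add, finite} \<Rightarrow> 'a"
  assumes "quasilinear_cycle_set \<tau>"
  shows "transitive_action (ext_perm_group \<tau>) (carrier (perm_group \<tau>)) (alpha \<tau>)"
proof -
  interpret finite_quasilinear_cycle_set \<tau>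
    by standard (rule assms)
  show ?thesis
    unfolding carrier_perm_group by (rule transitive_action_alpha)
qed

end
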